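(* Let $P$ be a path, and let $G$ and $H$ be graphs. Then $\lvert t(P,G)-t(P,H)\rvert\le \mathsf{e}(P)\cdot\delta^{\mathcal{P}}_{2}(G,H)$, where $\mathsf{e}(P)$ is the number of edges of $P$.
   Context: Graphs are finite, simple, undirected; a path is a path graph. For graphs $F,G$, $\hom(F,G)$ is the number of maps $\varphi\colon V(F)\to V(G)$ mapping edges to edges, and $t(F,G)=\hom(F,G)/|V(G)|^{|V(F)|}$. Write $\mathsf{v}(G)=|V(G)|$. A signed fractional overlay of $G$ and $H$ is a matrix $X\in\mathbb{R}^{V(G)\times V(H)}$ such that $\|Xy\|_2\le\|y\|_2/\sqrt{\mathsf{v}(G)\mathsf{v}(H)}$ for every $y\in\mathbb{R}^{V(H)}$, $\sum_{v\in V(H)}X_{uv}=1/\mathsf{v}(G)$ for every $u\in V(G)$, and $\sum_{u\in V(G)}X_{uv}=1/\mathsf{v}(H)$ for every $v\in V(H)$; $\mathcal{S}(G,H)$ is the set of these. With $A,B$ the adjacency matrices of $G,H$ and $\|\cdot\|_2$ the spectral norm, the path distance is $\delta^{\mathcal{P}}_{2}(G,H)=\inf_{X\in\mathcal{S}(G,H)}\frac{1}{\sqrt{\mathsf{v}(G)\mathsf{v}(H)}}\|\mathsf{v}(H)\,AX-\mathsf{v}(G)\,XB\|_2$. *)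

theory Defs
  imports "HOL-Analysis.Analysis"
begin

text \<open>
  A graph with vertex set the (nonempty) finite type \<open>'a\<close> is given by its set of edges,
  which are two-element sets of vertices; \<open>card G\<close> is the number of edges.
\<close>

type_synonym 'a graph = "'a set set"

definition simple_graph :: "'a::finite graph \<Rightarrow> bool" where
  "simple_graph G \<longleftrightarrow> (\<forall>e\<in>G. card e = 2)"

definition path_graph :: "'a::finite graph \<Rightarrow> bool" where
  "path_graph P \<longleftrightarrow>
     (\<exists>xs. distinct xs \<and> set xs = UNIV \<and> P = {{xs ! i, xs ! Suc i} | i. Suc i < length xs})"

lemma path_graph_imp_simple_graph: "path_graph P \<Longrightarrow> simple_graph P"
  by (auto simp: path_graph_def simple_graph_def nth_eq_iff_index_eq)

definition hom_count :: "'a::finite graph \<Rightarrow> 'b::finite graph \<Rightarrow> nat" where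
  "hom_count F G = card {\<phi> :: 'a \<Rightarrow> 'b. \<forall>e\<in>F. \<phi> ` e \<in> G}"

definition hom_density :: "'a::finite graph \<Rightarrow> 'b::finite graph \<Rightarrow> real" where
  "hom_density F G = real (hom_count F G) / real CARD('b) ^ CARD('a)"

definition adjacency_matrix :: "'a::finite graph \<Rightarrow> real ^ 'a ^ 'a" where
  "adjacency_matrix G = (\<chi> u v. if {u, v} \<in> G then 1 else 0)"

text \<open>The norm on \<open>real ^ 'n\<close> is Euclidean, so its operator norm is the spectral norm.\<close>

definition spectral_norm :: "real ^ 'n ^ 'm \<Rightarrow> real" where
  "spectral_norm M = onorm (\<lambda>x. M *v x)"

text \<open>
  The overlays of \<open>G\<close> and \<open>H\<close> depend only on their vertex sets, here the types \<open>'g\<close> and \<open>'h\<close>;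
  rows are indexed by \<open>'g\<close> and columns by \<open>'h\<close>.
\<close>

definition signed_fractional_overlays :: "(real ^ 'h::finite ^ 'g::finite) set" where
  "signed_fractional_overlays =
     {X. (\<forall>y. norm (X *v y) \<le> norm y / sqrt (real CARD('g) * real CARD('h))) \<and>
         (\<forall>u. (\<Sum>v\<in>UNIV. X $ u $ v) = 1 / real CARD('g)) \<and>
         (\<forall>v. (\<Sum>u\<in>UNIV. X $ u $ v) = 1 / real CARD('h))}"

definition path_distance :: "'g::finite graph \<Rightarrow> 'h::finite graph \<Rightarrow> real" where
  "path_distance G H =
     (INF X \<in> (signed_fractional_overlays :: (real ^ 'h ^ 'g) set).
        1 / sqrt (real CARD('g) * real CARD('h)) *
        spectral_norm (real CARD('h) *\<^sub>R (adjacency_matrix G ** X)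
                       - real CARD('g) *\<^sub>R (X ** adjacency_matrix H)))"

text \<open>The infimum is over a nonempty set of reals that is bounded below.\<close>

lemma signed_fractional_overlays_nonempty:
  "(signed_fractional_overlays :: (real ^ 'h::finite ^ 'g::finite) set) \<noteq> {}"
proof -
  define g h where "g = real CARD('g)" and "h = real CARD('h)"
  have pos: "g > 0" "h > 0" by (auto simp: g_def h_def)
  define X :: "real ^ 'h ^ 'g" where "X = (\<chi> u v. 1 / (g * h))"
  have "norm (X *v y) \<le> norm y / sqrt (g * h)" for y :: "real ^ 'h"
  proof -
    define o1 :: "real ^ 'h" where "o1 = (\<chi> v. 1)"
    have no: "norm o1 = sqrt h"
      by (simp add: o1_def norm_vec_def L2_set_def h_def)
    have "X *v y = (\<chi> u. (o1 \<bullet> y) / (g * h))"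
      by (simp add: vec_eq_iff X_def matrix_vector_mult_def o1_def inner_vec_def sum_divide_distrib)
    then have "norm (X *v y) = sqrt g * (\<bar>o1 \<bullet> y\<bar> / (g * h))"
      using pos by (simp add: norm_vec_def L2_set_def real_sqrt_mult flip: g_def)
    also have "\<dots> \<le> sqrt g * ((sqrt h * norm y) / (g * h))"
      using pos Cauchy_Schwarz_ineq2[of o1 y] no
      by (intro mult_left_mono divide_right_mono) auto
    also have "\<dots> = norm y / sqrt (g * h)"
    proof -
      have "a * (b * n / ((a * a) * (b * b))) = n / (a * b)"
        if "a > 0" "b > 0" for a b n :: real
        using that by (simp add: field_simps)
      from this[of "sqrt g" "sqrt h" "norm y"] show ?thesis
        using pos by (simp add: real_sqrt_mult)
    qed
    finally show ?thesis .
  qed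
  moreover have "(\<Sum>v\<in>UNIV. X $ u $ v) = 1 / g" for u
    using pos by (simp add: X_def flip: h_def)
  moreover have "(\<Sum>u\<in>UNIV. X $ u $ v) = 1 / h" for v
    using pos by (simp add: X_def flip: g_def)
  ultimately have "X \<in> signed_fractional_overlays"
    by (simp add: signed_fractional_overlays_def flip: g_def h_def)
  then show ?thesis by blast
qed

lemma spectral_norm_nonneg: "spectral_norm M \<ge> 0"
  unfolding spectral_norm_def
  by (intro onorm_pos_le matrix_vector_mul_bounded_linear)

end

theory Submission
  imports Defs
begin

text \<open>
  Let \<open>a\<^sub>i = (A / v(G))\<^sup>i 1\<close> and \<open>b\<^sub>j = (B / v(H))\<^sup>j 1\<close>. For the path with \<open>k\<close> edges and an overlay
  \<open>X\<close>, the row and column sums of \<open>X\<close> give \<open>t(P, G) = a\<^sub>k \<bullet> X b\<^sub>0\<close> and \<open>t(P, H) = a\<^sub>0 \<bullet> X b\<^sub>k\<close>.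
  Since \<open>A\<close> is symmetric, the difference telescopes into the \<open>k\<close> terms
  \<open>a\<^sub>i \<bullet> (A X / v(G) - X B / v(H)) b\<^sub>j\<close> with \<open>i + j = k - 1\<close>, and each of them is bounded by
  Cauchy-Schwarz because the entries of \<open>a\<^sub>i\<close> and \<open>b\<^sub>j\<close> lie in \<open>[0, 1]\<close>.
\<close>

primrec walk_density :: "'a::finite graph \<Rightarrow> nat \<Rightarrow> real ^ 'a" where
  "walk_density G 0 = 1"
| "walk_density G (Suc n) = (1 / real CARD('a)) *\<^sub>R (adjacency_matrix G *v walk_density G n)"

lemma adjacency_matrix_mult_nth:
  "(adjacency_matrix G *v x) $ u = (\<Sum>v | {u, v} \<in> G. x $ v)"
  by (simp add: adjacency_matrix_def matrix_vector_mult_def if_distrib if_distribR sum.If_cases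
      cong: if_cong)

lemma transpose_adjacency_matrix: "transpose (adjacency_matrix G) = adjacency_matrix G"
  by (simp add: transpose_def adjacency_matrix_def vec_eq_iff insert_commute)

text \<open>Each entry of the next vector is a sum of at most \<open>CARD('a)\<close> entries from
  [0, 1], divided by \<open>CARD('a)\<close>.\<close>

lemma walk_density_bounds: "0 \<le> walk_density G n $ u \<and> walk_density G n $ u \<le> 1"
proof (induction n arbitrary: u)
  case (Suc n)
  have "(\<Sum>v | {u, v} \<in> G. walk_density G n $ v) \<le> (\<Sum>v\<in>(UNIV :: 'a set). 1)"
    using Suc.IH
    by (intro order_trans[OF sum_mono sum_mono2]) auto
  moreover have "0 \<le> (\<Sum>v | {u, v} \<in> G. walk_density G n $ v)"
    using Suc.IH by (intro sum_nonneg) auto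
  ultimately show ?case
    by (simp add: adjacency_matrix_mult_nth)
qed auto

lemma norm_walk_density_le: "norm (walk_density (G :: 'a::finite graph) n) \<le> sqrt (real CARD('a))"
proof -
  have "(\<Sum>u\<in>UNIV. (walk_density G n $ u)\<^sup>2) \<le> (\<Sum>u\<in>(UNIV :: 'a set). 1)"
    using walk_density_bounds by (intro sum_mono power_le_one) auto
  then show ?thesis
    by (simp add: norm_vec_def L2_set_def)
qed

text \<open>A walk with \<open>n\<close> edges is encoded by its \<open>Suc n\<close> vertices,
  repetitions allowed. Fixing the first vertex matches the count with a single entry of
  \<open>walk_density\<close>.\<close>

definition walks_from :: "'a graph \<Rightarrow> nat \<Rightarrow> 'a \<Rightarrow> 'a list set" where
  "walks_from G n u =
     {ys. length ys = Suc n \<and> hd ys = u \<and> successively (\<lambda>v w. {v, w} \<in> G) ys}"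

lemma finite_walks_from: "finite (walks_from (G :: 'a::finite graph) n u)"
  by (rule finite_subset[OF _ finite_lists_length_eq[of UNIV "Suc n"]]) (auto simp: walks_from_def)

lemma walks_from_0: "walks_from G 0 u = {[u]}"
  by (auto simp: walks_from_def length_Suc_conv)

lemma walks_from_Suc: "walks_from G (Suc n) u = (\<Union>v\<in>{v. {u, v} \<in> G}. (#) u ` walks_from G n v)"
  by (force simp: walks_from_def length_Suc_conv)

text \<open>Deleting the first vertex leaves a walk from a neighbour of \<open>u\<close>, which
  amounts to one multiplication by the adjacency matrix. The power of \<open>CARD('a)\<close> undoes
  the normalisation.\<close>

lemma card_walks_from:
  "real (card (walks_from (G :: 'a::finite graph) n u)) = real CARD('a) ^ n * walk_density G n $ u"
proof (induction n arbitrary: u)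
  case (Suc n)
  \<comment> \<open>The union is disjoint because the second vertex of a walk determines
    \<open>v\<close>.\<close>
  have "card (walks_from G (Suc n) u) = (\<Sum>v | {u, v} \<in> G. card ((#) u ` walks_from G n v))"
    unfolding walks_from_Suc
    by (intro card_UN_disjoint) (auto simp: finite_walks_from, auto simp: walks_from_def)
  also have "\<dots> = (\<Sum>v | {u, v} \<in> G. card (walks_from G n v))"
    by (intro sum.cong card_image) auto
  finally show ?case
    by (simp add: Suc.IH adjacency_matrix_mult_nth sum_distrib_left)
qed (simp add: walks_from_0)

text \<open>With \<open>xs\<close> the vertices of a path in order, this encodes a map by its list
  of values, so that homomorphisms can be counted as walks.\<close>

lemma map_bij_betw_lists_length_eq:
  assumes "distinct xs" "set xs = UNIV"
  shows "bij_betw (\<lambda>\<phi>. map \<phi> xs) UNIV {ys. length ys = length xs}"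
proof (rule bij_betwI')
  fix \<phi> \<psi> :: "'a \<Rightarrow> 'b"
  show "(map \<phi> xs = map \<psi> xs) = (\<phi> = \<psi>)"
    using assms by (auto simp: fun_eq_iff)
next
  fix ys :: "'b list"
  assume "ys \<in> {ys. length ys = length xs}"
  then have len: "length xs = length ys" by simp
  \<comment> \<open>The preimage of \<open>ys\<close> sends each vertex to the entry of
    \<open>ys\<close> at its position in \<open>xs\<close>.\<close>
  have "map (\<lambda>x. the (map_of (zip xs ys) x)) xs = ys"
    using assms(1) len by (intro nth_equalityI) (simp_all add: map_of_zip_nth)
  then show "\<exists>\<phi>\<in>UNIV. ys = map \<phi> xs" by (intro bexI[of _ "\<lambda>x. the (map_of (zip xs ys) x)"]) simp_all
qed auto

text \<open>Different positions give different edges: a crossed coincidence would need both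
  \<open>i = Suc j\<close> and \<open>j = Suc i\<close>. Truncated subtraction covers the empty
  list.\<close>

lemma card_path_edges:
  assumes "distinct xs"
  shows "card {{xs ! i, xs ! Suc i} | i. Suc i < length xs} = length xs - 1"
proof -
  have "inj_on (\<lambda>i. {xs ! i, xs ! Suc i}) {..<length xs - 1}"
    using assms by (auto simp: inj_on_def doubleton_eq_iff nth_eq_iff_index_eq)
  moreover have "{{xs ! i, xs ! Suc i} | i. Suc i < length xs}
      = (\<lambda>i. {xs ! i, xs ! Suc i}) ` {..<length xs - 1}"
    by auto
  ultimately show ?thesis by (simp add: card_image)
qed

lemma path_graph_card:
  assumes "path_graph (P :: 'p::finite graph)"
  shows "CARD('p) = Suc (card P)"
proof -
  obtain xs :: "'p list" where xs: "distinct xs" "set xs = UNIV"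
      "P = {{xs ! i, xs ! Suc i} | i. Suc i < length xs}"
    using assms unfolding path_graph_def by blast
  have "CARD('p) = length xs"
    using distinct_card[OF xs(1)] xs(2) by simp
  moreover have "card P = length xs - 1"
    using card_path_edges[OF xs(1)] xs(3) by simp
  \<comment> \<open>Positivity makes the truncated \<open>length xs - 1\<close> a true
    predecessor.\<close>
  moreover have "CARD('p) > 0" by simp
  ultimately show ?thesis by linarith
qed

text \<open>Homomorphisms from a path are walks with \<open>card P\<close> edges. Of the
  \<open>Suc (card P)\<close> normalising factors all but one are absorbed by
  \<open>walk_density\<close>.\<close>

lemma hom_density_path:
  assumes "path_graph (P :: 'p::finite graph)"
  shows "hom_density P (G :: 'g::finite graph) = (1 \<bullet> walk_density G (card P)) / real CARD('g)"
proof -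
  obtain xs :: "'p list" where xs: "distinct xs" "set xs = UNIV"
      "P = {{xs ! i, xs ! Suc i} | i. Suc i < length xs}"
    using assms unfolding path_graph_def by blast
  define k where "k = card P"
  have len: "length xs = Suc k"
    using distinct_card[OF xs(1)] xs(2) path_graph_card[OF assms] by (simp add: k_def)
  let ?homs = "{\<phi> :: 'p \<Rightarrow> 'g. \<forall>e\<in>P. \<phi> ` e \<in> G}"
  have "P = (\<lambda>i. {xs ! i, xs ! Suc i}) ` {i. Suc i < length xs}"
    by (auto simp: xs(3))
  then have "successively (\<lambda>v w. {v, w} \<in> G) (map \<phi> xs) \<longleftrightarrow> (\<forall>e\<in>P. \<phi> ` e \<in> G)" for \<phi> :: "'p \<Rightarrow> 'g"
    by (simp add: successively_conv_nth)
  \<comment> \<open>Written as a preimage, the set of homomorphisms has as its image the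
    intersection with the range, which the bijection identifies as all lists of length
    \<open>Suc k\<close>.\<close>
  then have homs: "?homs = (\<lambda>\<phi>. map \<phi> xs) -` Collect (successively (\<lambda>v w. {v, w} \<in> G))"
    by auto
  note bij = map_bij_betw_lists_length_eq[OF xs(1,2), where 'b = 'g]
  have "(\<lambda>\<phi>. map \<phi> xs) ` ?homs
      = {ys. length ys = Suc k \<and> successively (\<lambda>v w. {v, w} \<in> G) ys}"
    unfolding homs image_vimage_eq bij_betw_imp_surj_on[OF bij] len by auto
  then have "bij_betw (\<lambda>\<phi>. map \<phi> xs) ?homs
      {ys. length ys = Suc k \<and> successively (\<lambda>v w. {v, w} \<in> G) ys}"
    by (intro bij_betw_subset[OF bij]) auto
  moreover have "{ys. length ys = Suc k \<and> successively (\<lambda>v w. {v, w} \<in> G) ys}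
      = (\<Union>u. walks_from G k u)"
    by (auto simp: walks_from_def)
  ultimately have "hom_count P G = card (\<Union>u. walks_from G k u)"
    unfolding hom_count_def by (simp add: bij_betw_same_card)
  also have "\<dots> = (\<Sum>u\<in>UNIV. card (walks_from G k u))"
    by (intro card_UN_disjoint) (auto simp: finite_walks_from, auto simp: walks_from_def)
  finally have "real (hom_count P G) = real CARD('g) ^ k * (1 \<bullet> walk_density G k)"
    by (simp add: card_walks_from inner_vec_def sum_distrib_left)
  then show ?thesis
    using path_graph_card[OF assms] by (simp add: hom_density_def k_def)
qed

text \<open>The bound is proved for each overlay separately; the infimum is taken only in the
  theorem.\<close>

lemma overlay_hom_density_path_diff_le:
  fixes G :: "'g::finite graph" and H :: "'h::finite graph" and X :: "real ^ 'h ^ 'g"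
  assumes P: "path_graph P" and X: "X \<in> signed_fractional_overlays"
  shows "\<bar>hom_density P G - hom_density P H\<bar> \<le> real (card P) *
    (1 / sqrt (real CARD('g) * real CARD('h)) *
     spectral_norm (real CARD('h) *\<^sub>R (adjacency_matrix G ** X)
                    - real CARD('g) *\<^sub>R (X ** adjacency_matrix H)))"
proof -
  define g h k where "g = real CARD('g)" and "h = real CARD('h)" and "k = card P"
  have pos: "g > 0" "h > 0" by (auto simp: g_def h_def)
  define A B where "A = adjacency_matrix G" and "B = adjacency_matrix H"
  define M where "M = h *\<^sub>R (A ** X) - g *\<^sub>R (X ** B)"
  define a b where "a = walk_density G" and "b = walk_density H"
  \<comment> \<open>Up to normalisation, \<open>S i\<close> counts pairs of walks, with
    \<open>i\<close> edges in \<open>G\<close> and \<open>k - i\<close> in \<open>H\<close>,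
    weighted by \<open>X\<close> at their starting vertices.\<close>
  define S where "S i = a i \<bullet> (X *v b (k - i))" for i
  have a_Suc: "a (Suc i) = (1 / g) *\<^sub>R (A *v a i)" and b_Suc: "b (Suc i) = (1 / h) *\<^sub>R (B *v b i)" for i
    by (simp_all add: a_def b_def A_def B_def g_def h_def)
  have sums: "(\<Sum>v\<in>UNIV. X $ u $ v) = 1 / g" "(\<Sum>u\<in>UNIV. X $ u $ v) = 1 / h" for u v
    using X by (simp_all add: signed_fractional_overlays_def g_def h_def)
  have X1: "X *v 1 = (1 / g) *\<^sub>R 1"
    by (simp add: vec_eq_iff matrix_vector_mult_def sums)
  have X1': "transpose X *v 1 = (1 / h) *\<^sub>R 1"
    by (simp add: vec_eq_iff matrix_vector_mult_def transpose_def sums)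
  have "S k = (1 \<bullet> a k) / g"
    by (simp add: S_def b_def X1 inner_commute)
  moreover have "S 0 = (1 \<bullet> b k) / h"
    using X1' by (simp add: S_def a_def flip: dot_lmul_matrix)
  ultimately have diff: "hom_density P G - hom_density P H = S k - S 0"
    by (simp add: hom_density_path[OF P] a_def b_def g_def h_def k_def)
  have step: "\<bar>S (Suc i) - S i\<bar> \<le> spectral_norm M / sqrt (g * h)" if "i < k" for i
  proof -
    define j where "j = k - Suc i"
    have kj: "k - i = Suc j" using that by (simp add: j_def)
    \<comment> \<open>Symmetry of \<open>A\<close> moves the last factor of \<open>a (Suc i)\<close>
      to the other side, next to \<open>X\<close>.\<close>
    have "(A *v a i) \<bullet> z = a i \<bullet> (A *v z)" for z
      by (metis A_def dot_lmul_matrix transpose_adjacency_matrix vector_transpose_matrix)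
    then have "S (Suc i) - S i = (1 / g) * (a i \<bullet> (A *v (X *v b j))) - (1 / h) * (a i \<bullet> (X *v (B *v b j)))"
      unfolding S_def kj j_def[symmetric] a_Suc b_Suc
      by (simp add: matrix_vector_mult_scaleR)
    \<comment> \<open>Over the common denominator \<open>g * h\<close>, the difference of
      \<open>A X / g\<close> and \<open>X B / h\<close> becomes \<open>M\<close>.\<close>
    also have "\<dots> = (a i \<bullet> (M *v b j)) / (g * h)"
      using pos
      by (simp add: M_def matrix_vector_mult_diff_rdistrib matrix_vector_mul_assoc
          scaleR_matrix_vector_assoc[symmetric] inner_diff_right field_simps)
    finally have "\<bar>S (Suc i) - S i\<bar> = \<bar>a i \<bullet> (M *v b j)\<bar> / (g * h)"
      using pos by (simp add: abs_mult)
    also have "\<dots> \<le> (norm (a i) * norm (M *v b j)) / (g * h)"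
      using pos by (intro divide_right_mono Cauchy_Schwarz_ineq2) auto
    also have "\<dots> \<le> (sqrt g * (spectral_norm M * sqrt h)) / (g * h)"
    proof (intro divide_right_mono mult_mono)
      show "norm (a i) \<le> sqrt g"
        unfolding a_def g_def by (rule norm_walk_density_le)
      have "norm (M *v b j) \<le> spectral_norm M * norm (b j)"
        unfolding spectral_norm_def by (intro onorm matrix_vector_mul_bounded_linear)
      also have "\<dots> \<le> spectral_norm M * sqrt h"
        unfolding b_def h_def by (intro mult_left_mono norm_walk_density_le spectral_norm_nonneg)
      finally show "norm (M *v b j) \<le> spectral_norm M * sqrt h" .
    qed (use pos in auto)
    also have "\<dots> = spectral_norm M * (sqrt (g * h) / (g * h))"
      by (simp add: real_sqrt_mult)
    also have "\<dots> = spectral_norm M / sqrt (g * h)"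
      using pos by (subst sqrt_divide_self_eq) (simp_all add: divide_inverse)
    finally show ?thesis .
  qed
  have "S k - S 0 = (\<Sum>i<k. S (Suc i) - S i)"
    by (rule sum_lessThan_telescope[symmetric])
  also have "\<bar>\<dots>\<bar> \<le> (\<Sum>i<k. spectral_norm M / sqrt (g * h))"
    by (intro order_trans[OF sum_abs sum_mono] step) auto
  finally show ?thesis
    unfolding diff by (simp add: M_def A_def B_def g_def h_def k_def)
qed

theorem theorem9:
  fixes P :: "'p::finite graph" and G :: "'g::finite graph" and H :: "'h::finite graph"
  assumes "path_graph P" and "simple_graph G" and "simple_graph H"
  shows "\<bar>hom_density P G - hom_density P H\<bar> \<le> real (card P) * path_distance G H"
proof (cases "card P = 0")
  case True
  \<comment> \<open>Without edges the per-overlay bound is 0, so any one overlay suffices.\<close>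
  obtain X :: "real ^ 'h ^ 'g" where "X \<in> signed_fractional_overlays"
    using signed_fractional_overlays_nonempty by blast
  from overlay_hom_density_path_diff_le[OF assms(1) this, of G H] True show ?thesis
    by simp
next
  case False
  then have pos: "real (card P) > 0" by linarith
  \<comment> \<open>Dividing by the number of edges leaves a constant that bounds every member of
    the infimum from below.\<close>
  have "\<bar>hom_density P G - hom_density P H\<bar> / real (card P) \<le> path_distance G H"
    unfolding path_distance_def
  proof (rule cINF_greatest[OF signed_fractional_overlays_nonempty])
    fix X :: "real ^ 'h ^ 'g"
    assume "X \<in> signed_fractional_overlays"
    from overlay_hom_density_path_diff_le[OF assms(1) this, of G H]
    show "\<bar>hom_density P G - hom_density P H\<bar> / real (card P) \<le>
        1 / sqrt (real CARD('g) * real CARD('h)) *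
        spectral_norm (real CARD('h) *\<^sub>R (adjacency_matrix G ** X)
                       - real CARD('g) *\<^sub>R (X ** adjacency_matrix H))"
      by (simp add: pos_divide_le_eq[OF pos] mult.commute)
  qed
  then show ?thesis
    by (simp add: pos_divide_le_eq[OF pos] mult.commute)
qed

end
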